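(* For any integer $m\ge 2$, there exists a set $\mathcal{B}\subseteq\mathbb{N}$ satisfying the $c$-condition (see context) such that $$\mathcal{B}(x)\gg x\exp\!\left(-\frac{2}{m}(\log x)^{1/m}\log\log x\right)$$ and $$\mathcal{S}(x)=\#\{n\le x:\ n=p+b,\ p\in\mathcal{P},\ b\in\mathcal{B}\}\ll \frac{x}{\log\log\log x},$$ where both estimates hold for all sufficiently large $x$ with implied constants independent of $x$.
   Context: $\mathbb{N}$ denotes the set of positive integers and $\mathcal{P}$ the set of primes; $\exp(y)=e^y$. For a set $\mathcal{A}\subseteq\mathbb{N}$, $\mathcal{A}(x)=|\mathcal{A}\cap[1,x]|$. A set $\mathcal{B}\subseteq\mathbb{N}$ is said to satisfy the $c$-condition if there is a constant $0<c<1$ such that $\mathcal{B}(cx)\gg\mathcal{B}(x)$, i.e. there is a constant $K>0$ with $\mathcal{B}(cx)\ge K\,\mathcal{B}(x)$ for all sufficiently large $x$. $\mathcal{S}(x)$ counts the distinct integers $n\le x$ representable as $p+b$ with $p$ prime and $b\in\mathcal{B}$. *)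

theory Defs
  imports
    Complex_Main
    "HOL-Library.Landau_Symbols"
    "HOL-Computational_Algebra.Primes"
begin

definition counting :: "nat set \<Rightarrow> real \<Rightarrow> nat" where
  "counting A x = card {n \<in> A. 1 \<le> n \<and> real n \<le> x}"

definition c_condition :: "nat set \<Rightarrow> bool" where
  "c_condition B \<longleftrightarrow>
     (\<exists>c::real. 0 < c \<and> c < 1 \<and>
        (\<exists>K>0. \<forall>\<^sub>F x in at_top. real (counting B (c * x)) \<ge> K * real (counting B x)))"

definition primes_plus :: "nat set \<Rightarrow> nat set" where
  "primes_plus B = {p + b | p b. prime p \<and> b \<in> B}"

end

theory Submission
  imports
    Defs
    "HOL-Analysis.Harmonic_Numbers"
    "HOL-Number_Theory.Totient"
    "HOL-Real_Asymp.Real_Asymp"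
begin

text \<open>Take \<open>B\<close> to be the integers \<open>b\<close> divisible by \<open>M(b)!\<close>, where
  \<open>M(b) = \<lfloor>(log b)\<^sup>1\<^sup>/\<^sup>m\<rfloor>\<close>. Every multiple of \<open>M(x)!\<close> up to \<open>x\<close> lies in \<open>B\<close>,
  and every element of \<open>B\<close> above \<open>y\<close> is a multiple of \<open>M(y)!\<close>; this gives the lower bound
  and the \<open>c\<close>-condition with \<open>c = 1/2\<close>. To bound the sums \<open>p + b \<le> x\<close>, put
  \<open>z = (log x)\<^sup>1\<^sup>/\<^sup>2\<close>. By Chebyshev there are \<open>O(x z / log x)\<close> sums with \<open>b \<le> z\<close>. If
  \<open>b > z\<close>, then \<open>p + b\<close> is coprime to \<open>M(z)!\<close> unless \<open>p \<le> M(z)\<close>, and such integers have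
  density \<open>O(1 / log M(z)) = O(1 / log log log x)\<close>.\<close>

section \<open>Chebyshev's upper bound\<close>

lemma prod_distinct_primes_dvd:
  fixes n :: nat
  assumes "finite A" "\<And>p. p \<in> A \<Longrightarrow> prime p \<and> p dvd n"
  shows "\<Prod>A dvd n"
  using assms
proof (induction A rule: finite_induct)
  case (insert p A)
  have "coprime p (\<Prod>A)"
  proof (rule prod_coprime_right)
    fix q assume "q \<in> A"
    then have "prime p" "prime q" "p \<noteq> q"
      using insert.hyps insert.prems by blast+
    then show "coprime p q"
      by (rule primes_coprime)
  qed
  moreover have "p dvd n" "\<Prod>A dvd n"
    using insert by blast+
  ultimately have "p * \<Prod>A dvd n"
    by (intro divides_mult)
  then show ?case
    using insert.hyps by simp
qed simp

text \<open>A prime in the range divides \<open>fact n\<close>, but neither \<open>fact k\<close>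
  nor \<open>fact (n - k)\<close>, because \<open>n - k \<le> k < p\<close>. It must therefore
  divide the remaining factor, the binomial coefficient.\<close>

lemma prod_primes_dvd_binomial:
  fixes k n :: nat
  assumes "k \<le> n" "n \<le> 2 * k"
  shows "\<Prod>{p. prime p \<and> k < p \<and> p \<le> n} dvd n choose k"
proof (rule prod_distinct_primes_dvd)
  fix p assume p: "p \<in> {p. prime p \<and> k < p \<and> p \<le> n}"
  then have "p dvd fact n"
    by (simp add: prime_dvd_fact_iff)
  also have "fact n = fact k * fact (n - k) * (n choose k)"
    using binomial_fact_lemma[OF assms(1)] by simp
  finally show "prime p \<and> p dvd n choose k"
    using p assms by (auto simp: prime_dvd_mult_iff prime_dvd_fact_iff)
qed auto

text \<open>Row \<open>2 * k + 1\<close> has two equal middle entries, and together they are at most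
  the row sum \<open>2 * 4 ^ k\<close>.\<close>

lemma choose_middle_odd_le: "(2 * k + 1) choose (k + 1) \<le> (4::nat) ^ k"
proof -
  define n where "n = 2 * k + 1"
  have "n - k = k + 1" "k \<le> n"
    by (simp_all add: n_def)
  then have "n choose (k + 1) = n choose k"
    by (metis binomial_symmetric)
  then have "2 * (n choose (k + 1)) = (n choose k) + (n choose (k + 1))"
    by linarith
  also have "\<dots> = (\<Sum>i\<in>{k, k + 1}. n choose i)"
    by simp
  also have "\<dots> \<le> (\<Sum>i\<le>n. n choose i)"
    by (rule sum_mono2) (auto simp: n_def)
  also have "\<dots> = 2 ^ n"
    by (rule choose_row_sum)
  also have "\<dots> = 2 * 4 ^ k"
    by (simp add: n_def power_mult)
  finally show ?thesis unfolding n_def by linarith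
qed

text \<open>Erdos's induction. An even \<open>n > 2\<close> is not prime, so the product is that of
  \<open>n - 1\<close>. For \<open>n = 2 * k + 1\<close> the primes up to \<open>k + 1\<close> fall
  under the induction hypothesis, and the larger ones have a product dividing the middle binomial
  coefficient.\<close>

lemma primorial_le: "\<Prod>{p. prime p \<and> p \<le> n} \<le> (4::nat) ^ n"
proof (induction n rule: less_induct)
  case (less n)
  have "n \<le> 1 \<or> n = 2 \<or> n > 2 \<and> even n \<or> n > 1 \<and> odd n"
    by (cases "even n") linarith+
  then consider "n \<le> 1" | "n = 2" | "n > 2" "even n" | "n > 1" "odd n"
    by blast
  then show ?case
  proof cases
    case 1
    then have *: "{p. prime p \<and> p \<le> n} = {}"
      by (auto dest: prime_gt_1_nat)
    show ?thesis unfolding * by simp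
  next
    case 2
    then have "{p. prime p \<and> p \<le> n} = {2}"
      by (auto dest: prime_ge_2_nat intro: antisym)
    with 2 show ?thesis by simp
  next
    case 3
    then have "\<not> prime n"
      by (metis prime_odd_nat)
    then have "p \<le> n \<longleftrightarrow> p \<le> n - 1" if "prime p" for p
    proof -
      have "p \<noteq> n"
        using that \<open>\<not> prime n\<close> by blast
      then show ?thesis
        using 3 by arith
    qed
    then have *: "{p. prime p \<and> p \<le> n} = {p. prime p \<and> p \<le> n - 1}"
      by blast
    have "\<Prod>{p. prime p \<and> p \<le> n} \<le> 4 ^ (n - 1)"
      unfolding * using 3 by (intro less) simp
    also have "\<dots> \<le> 4 ^ n"
      by (rule power_increasing) auto
    finally show ?thesis .
  next
    case 4
    from \<open>odd n\<close> obtain k where "n = 2 * k + 1"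
      by (rule oddE)
    with \<open>n > 1\<close> have k: "n = 2 * k + 1" "k \<ge> 1"
      by linarith+
    have "{p. prime p \<and> p \<le> n} =
        {p. prime p \<and> p \<le> k + 1} \<union> {p. prime p \<and> k + 1 < p \<and> p \<le> n}"
      using k by auto
    then have "\<Prod>{p. prime p \<and> p \<le> n} =
        \<Prod>{p. prime p \<and> p \<le> k + 1} * \<Prod>{p. prime p \<and> k + 1 < p \<and> p \<le> n}"
      by (subst prod.union_disjoint[symmetric]) auto
    also have "\<dots> \<le> 4 ^ (k + 1) * 4 ^ k"
    proof (rule mult_mono)
      show "\<Prod>{p. prime p \<and> p \<le> k + 1} \<le> 4 ^ (k + 1)"
        using k by (intro less) auto
      have "\<Prod>{p. prime p \<and> k + 1 < p \<and> p \<le> n} \<le> n choose (k + 1)"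
        using k by (intro dvd_imp_le[OF prod_primes_dvd_binomial zero_less_binomial]) auto
      also have "\<dots> \<le> 4 ^ k"
        using choose_middle_odd_le[of k] unfolding k(1) .
      finally show "\<Prod>{p. prime p \<and> k + 1 < p \<and> p \<le> n} \<le> 4 ^ k" .
    qed auto
    also have "\<dots> = 4 ^ n"
      unfolding k(1) power_add[symmetric] by (simp add: mult_2)
    finally show ?thesis .
  qed
qed

lemma finite_nat_le_real [simp, intro]: "finite {n::nat. P n \<and> real n \<le> x}"
  by (rule finite_subset[of _ "{..nat \<lfloor>x\<rfloor>}"]) (auto simp: le_nat_floor)

lemma ln_le_two_sqrt:
  assumes "(x::real) > 0"
  shows "ln x \<le> 2 * sqrt x"
  using ln_le_minus_one[of "sqrt x"] assms by (simp add: ln_sqrt)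

text \<open>The primes are split at \<open>sqrt x\<close>. The small ones are counted trivially and
  cost \<open>2 * x\<close>. Each large one exceeds \<open>sqrt x\<close>, so the primorial bound
  limits their number at a cost of \<open>4 * x\<close>.\<close>

lemma prime_counting_le:
  fixes x :: real
  assumes x: "x \<ge> 1"
  shows "real (card {p::nat. prime p \<and> real p \<le> x}) * ln x \<le> 6 * x"
proof -
  define A where "A = {p::nat. prime p \<and> real p \<le> sqrt x}"
  define B where "B = {p::nat. prime p \<and> sqrt x < p \<and> real p \<le> x}"
  have fin: "finite A" "finite B"
    unfolding A_def B_def using finite_nat_le_real[of "\<lambda>p. prime p \<and> sqrt x < real p" x]
    by (auto simp: conj_assoc)
  have "card {p::nat. prime p \<and> real p \<le> x} \<le> card (A \<union> B)"
    using fin by (intro card_mono) (auto simp: A_def B_def)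
  then have "card {p::nat. prime p \<and> real p \<le> x} \<le> card A + card B"
    using card_Un_le order_trans by blast
  then have split: "real (card {p::nat. prime p \<and> real p \<le> x}) \<le> real (card A) + real (card B)"
    by linarith
  have "card A \<le> card {1..nat \<lfloor>sqrt x\<rfloor>}"
    by (intro card_mono) (auto simp: A_def le_nat_floor dest: prime_gt_0_nat)
  then have "real (card A) \<le> sqrt x"
    using x by (simp add: le_nat_iff le_floor_iff)
  moreover have "ln x \<le> 2 * sqrt x"
    using x by (intro ln_le_two_sqrt) simp
  ultimately have "real (card A) * ln x \<le> sqrt x * (2 * sqrt x)"
    using x by (intro mult_mono) auto
  then have cA: "real (card A) * ln x \<le> 2 * x"
    using x by (simp only: mult.left_commute[of _ 2] real_sqrt_mult_self abs_of_nonneg)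
  have "sqrt x ^ card B = (\<Prod>p\<in>B. sqrt x)"
    by simp
  also have "\<dots> \<le> (\<Prod>p\<in>B. real p)"
    using x by (intro prod_mono) (auto simp: B_def)
  also have "\<dots> = real (\<Prod>B)"
    by simp
  also have "\<Prod>B \<le> \<Prod>{p. prime p \<and> p \<le> nat \<lfloor>x\<rfloor>}"
    by (intro dvd_imp_le prod_dvd_prod_subset prod_pos)
       (auto simp: B_def le_nat_floor dest: prime_gt_0_nat)
  also have "\<dots> \<le> 4 ^ nat \<lfloor>x\<rfloor>"
    by (rule primorial_le)
  finally have "sqrt x ^ card B \<le> 4 ^ nat \<lfloor>x\<rfloor>"
    by simp
  then have "ln (sqrt x ^ card B) \<le> ln (4 ^ nat \<lfloor>x\<rfloor>)"
    using x by (subst ln_le_cancel_iff) auto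
  then have "real (card B) * ln x / 2 \<le> real (nat \<lfloor>x\<rfloor>) * ln 4"
    using x by (simp add: ln_realpow ln_sqrt)
  also have "\<dots> \<le> x * 2"
  proof (rule mult_mono)
    show "ln (4::real) \<le> 2"
      using ln_le_minus_one[of "2::real"] ln_realpow[of "2::real" 2] by simp
  qed (use x in auto)
  finally have "real (card B) * ln x \<le> 4 * x"
    by simp
  moreover have "real (card {p::nat. prime p \<and> real p \<le> x}) * ln x
      \<le> (real (card A) + real (card B)) * ln x"
    using split x by (intro mult_right_mono) auto
  ultimately show ?thesis
    using cA by (simp add: distrib_right)
qed


section \<open>Integers coprime to a factorial\<close>

text \<open>Since \<open>gcd n j = j\<close>, the factor \<open>totient j\<close> cancels from the
  general identity \<open>totient_gcd\<close>.\<close>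

lemma totient_mult_dvd:
  assumes "j dvd n" "n > 0"
  shows "totient (n * j) = j * totient n"
proof -
  have "gcd n j = j" "j > 0"
    using assms by (auto simp: gcd_proj2_iff intro: dvd_pos_nat)
  then show ?thesis
    using totient_gcd[of n j] by simp
qed

text \<open>A Mertens type bound: splitting \<open>{1..W\<^sup>2}\<close>, where \<open>W = fact M\<close>, by the value of
  \<open>gcd n (W\<^sup>2)\<close>, the class of \<open>k \<le> M\<close> has \<open>totient (W * (W div k)) = (W div k) * totient W\<close>
  elements.\<close>

lemma totient_fact_harm_le: "real (totient (fact M)) * harm M \<le> fact M"
proof -
  define W :: nat where "W = fact M"
  have dvd: "k dvd W" if "k \<in> {1..M}" for k
    using that by (auto simp: W_def intro: dvd_fact)
  have W0: "W > 0" by (simp add: W_def)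
  have tot: "totient (W * (W div k)) = (W div k) * totient W" if "k \<in> {1..M}" for k
    using dvd[OF that] W0 by (intro totient_mult_dvd) auto
  have inj: "inj_on (\<lambda>k. W * (W div k)) {1..M}"
  proof (rule inj_onI)
    fix j k assume j: "j \<in> {1..M}" and k: "k \<in> {1..M}" and "W * (W div j) = W * (W div k)"
    then have "W div j = W div k"
      using W0 by simp
    moreover have "W div j * j = W" "W div k * k = W"
      using dvd[OF j] dvd[OF k] by auto
    ultimately show "j = k"
      using W0 by (metis mult_cancel1 mult_is_0 not_gr_zero)
  qed
  have "(\<Sum>k\<in>{1..M}. (W div k) * totient W) = (\<Sum>k\<in>{1..M}. totient (W * (W div k)))"
    using tot by simp
  also have "\<dots> = sum totient ((\<lambda>k. W * (W div k)) ` {1..M})"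
    using inj by (simp add: sum.reindex)
  \<comment> \<open>The numbers \<open>W * (W div k)\<close> are distinct divisors of
    \<open>W * W\<close>, so their totients form part of Gauss's divisor sum.\<close>
  also have "\<dots> \<le> (\<Sum>d | d dvd W * W. totient d)"
  proof (intro sum_mono2 image_subsetI CollectI mult_dvd_mono dvd_refl)
    show "W div k dvd W" if "k \<in> {1..M}" for k
      using dvd[OF that] by (metis dvd_div_mult_self dvd_triv_left)
  qed (use W0 in auto)
  also have "\<dots> = W * W"
    by (rule totient_divisor_sum)
  finally have "real (\<Sum>k\<in>{1..M}. (W div k) * totient W) \<le> real (W * W)"
    by (rule of_nat_mono)
  also have "real (\<Sum>k\<in>{1..M}. (W div k) * totient W) = (\<Sum>k\<in>{1..M}. real W / real k * totient W)"
    unfolding of_nat_sum using dvd by (intro sum.cong) (auto simp: real_of_nat_div)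
  also have "\<dots> = real W * (real (totient W) * harm M)"
    by (simp add: harm_def sum_distrib_left sum_distrib_right field_simps)
  finally have "real W * (real (totient W) * harm M) \<le> real W * real W"
    by simp
  then show ?thesis
    using W0 by (simp add: W_def)
qed

text \<open>The pair of quotient and residue modulo \<open>W\<close> determines \<open>n\<close>,
  and the residue is again coprime to \<open>W\<close>. The \<open>+ 1\<close> accounts for the
  incomplete last block.\<close>

lemma card_coprime_le:
  assumes "W > 1"
  shows "card {n. n \<le> N \<and> coprime n W} \<le> (N div W + 1) * totient W"
proof -
  have "card {n. n \<le> N \<and> coprime n W} \<le> card ({..N div W} \<times> totatives W)"
  proof (rule card_inj_on_le[where f = "\<lambda>n. (n div W, n mod W)"])
    show "inj_on (\<lambda>n. (n div W, n mod W)) {n. n \<le> N \<and> coprime n W}"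
      by (rule inj_onI) (metis div_mult_mod_eq prod.inject)
    show "(\<lambda>n. (n div W, n mod W)) ` {n. n \<le> N \<and> coprime n W} \<subseteq> {..N div W} \<times> totatives W"
    proof (intro image_subsetI SigmaI)
      fix n assume "n \<in> {n. n \<le> N \<and> coprime n W}"
      then have n: "n \<le> N" "coprime n W"
        by auto
      then have cop: "coprime (n mod W) W"
        using assms by (simp add: coprime_mod_left_iff)
      \<comment> \<open>\<open>totatives W\<close> contains only positive numbers; residue 0 is
        excluded because it is coprime to \<open>W\<close> only for \<open>W = 1\<close>.\<close>
      with assms have "n mod W \<noteq> 0"
        by (metis coprime_0_left_iff nat_dvd_1_iff_1 less_irrefl)
      with cop show "n mod W \<in> totatives W"
        using assms by (auto simp: in_totatives_iff intro: less_imp_le)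
      show "n div W \<in> {..N div W}"
        using n by (simp add: div_le_mono)
    qed
  qed auto
  then show ?thesis
    by (simp add: card_cartesian_product totient_def)
qed

lemma card_multiples:
  fixes x :: real
  assumes "d > 0"
  shows "card {n. 1 \<le> n \<and> real n \<le> x \<and> d dvd n} = nat \<lfloor>x / real d\<rfloor>"
proof -
  have "{n. 1 \<le> n \<and> real n \<le> x \<and> d dvd n} = (*) d ` {1..nat \<lfloor>x / real d\<rfloor>}"
  proof (intro equalityI subsetI)
    fix n assume "n \<in> {n. 1 \<le> n \<and> real n \<le> x \<and> d dvd n}"
    then obtain k where "n = d * k" "1 \<le> n" "real n \<le> x"
      by auto
    then show "n \<in> (*) d ` {1..nat \<lfloor>x / real d\<rfloor>}"
      using assms by (auto simp: le_nat_floor field_simps intro!: imageI)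
  next
    fix n assume "n \<in> (*) d ` {1..nat \<lfloor>x / real d\<rfloor>}"
    then obtain k where k: "n = d * k" "1 \<le> k" "int k \<le> \<lfloor>x / real d\<rfloor>"
      by force
    then have "real k \<le> x / real d"
      by (simp add: le_floor_iff)
    then show "n \<in> {n. 1 \<le> n \<and> real n \<le> x \<and> d dvd n}"
      using k assms by (auto simp: field_simps)
  qed
  moreover have "inj_on ((*) d) {1..nat \<lfloor>x / real d\<rfloor>}"
    using assms by (auto simp: inj_on_def)
  ultimately show ?thesis
    by (simp add: card_image)
qed


section \<open>The set of multiples of slowly growing factorials\<close>

definition root_log :: "nat \<Rightarrow> real \<Rightarrow> nat" where
  "root_log m x = nat \<lfloor>ln x powr (1 / real m)\<rfloor>"

definition fact_multiples :: "nat \<Rightarrow> nat set" where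
  "fact_multiples m = {n. 1 \<le> n \<and> fact (root_log m (real n)) dvd n}"

lemma root_log_mono:
  assumes "1 \<le> x" "x \<le> y"
  shows "root_log m x \<le> root_log m y"
  unfolding root_log_def using assms by (intro nat_mono floor_mono powr_mono2) auto

text \<open>The modulus varies with \<open>n\<close>, but the factorials form a divisibility chain.
  The modulus at an upper end \<open>x\<close> is thus sufficient for membership; dually,
  \<open>fact_multiples_dvd\<close> makes the modulus at a lower end \<open>y\<close>
  necessary.\<close>

lemma multiple_in_fact_multiples:
  assumes "1 \<le> n" "real n \<le> x" "fact (root_log m x) dvd n"
  shows "n \<in> fact_multiples m"
  using assms root_log_mono[of "real n" x m]
  by (auto simp: fact_multiples_def intro: dvd_trans fact_dvd)

lemma fact_multiples_dvd:
  assumes "n \<in> fact_multiples m" "1 \<le> y" "y \<le> real n"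
  shows "fact (root_log m y) dvd n"
  using assms root_log_mono[of y "real n" m]
  by (auto simp: fact_multiples_def intro: dvd_trans fact_dvd)

lemma finite_counting [simp, intro]: "finite {n \<in> A. 1 \<le> n \<and> real n \<le> x}"
  using finite_nat_le_real[of "\<lambda>n. n \<in> A \<and> 1 \<le> n" x] by (simp add: conj_assoc)

lemma counting_fact_multiples_ge:
  "nat \<lfloor>x / fact (root_log m x)\<rfloor> \<le> counting (fact_multiples m) x"
proof -
  let ?W = "fact (root_log m x) :: nat"
  have "nat \<lfloor>x / real ?W\<rfloor> = card {n. 1 \<le> n \<and> real n \<le> x \<and> ?W dvd n}"
    by (rule card_multiples[symmetric]) simp
  also have "\<dots> \<le> counting (fact_multiples m) x"
    unfolding counting_def
    by (intro card_mono finite_counting) (auto intro: multiple_in_fact_multiples)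
  finally show ?thesis by simp
qed

text \<open>Elements in \<open>(y, 2 * y]\<close> are multiples of \<open>W\<close>, and there are
  at most \<open>y / W + 1\<close> such multiples up to rounding. All multiples of \<open>W\<close>
  up to \<open>y\<close> lie in the set themselves, so this is at most the count at \<open>y\<close>
  plus 1.\<close>

lemma counting_fact_multiples_double:
  assumes y: "1 \<le> y"
  shows "counting (fact_multiples m) (2 * y) \<le> 3 * counting (fact_multiples m) y"
proof -
  let ?B = "fact_multiples m"
  define W :: nat where "W = fact (root_log m y)"
  define D where "D z = {n. 1 \<le> n \<and> real n \<le> z \<and> W dvd n}" for z
  have W: "W > 0" by (simp add: W_def)
  have fin: "finite (D z)" for z
    unfolding D_def using finite_nat_le_real[of "\<lambda>n. 1 \<le> n \<and> W dvd n" z]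
    by (rule finite_subset[rotated]) auto
  have "D y \<subseteq> D (2 * y)"
    using y by (auto simp: D_def)
  have "{n \<in> ?B. 1 \<le> n \<and> real n \<le> 2 * y} \<subseteq> {n \<in> ?B. 1 \<le> n \<and> real n \<le> y} \<union> (D (2 * y) - D y)"
    using y by (auto simp: D_def W_def intro!: fact_multiples_dvd)
  then have "counting ?B (2 * y) \<le> card ({n \<in> ?B. 1 \<le> n \<and> real n \<le> y} \<union> (D (2 * y) - D y))"
    unfolding counting_def using fin by (intro card_mono) auto
  also have "\<dots> \<le> counting ?B y + card (D (2 * y) - D y)"
    unfolding counting_def by (rule card_Un_le)
  also have "card (D (2 * y) - D y) = card (D (2 * y)) - card (D y)"
    using fin \<open>D y \<subseteq> D (2 * y)\<close> by (rule card_Diff_subset)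
  also have "\<dots> = nat \<lfloor>2 * y / W\<rfloor> - nat \<lfloor>y / W\<rfloor>"
    unfolding D_def using W by (simp only: card_multiples)
  also have "\<dots> \<le> nat \<lfloor>y / W\<rfloor> + 1"
  proof -
    have "\<lfloor>2 * (y / W)\<rfloor> \<le> 2 * \<lfloor>y / W\<rfloor> + 1" "0 \<le> \<lfloor>y / W\<rfloor>"
      using y by (linarith, simp)
    then show ?thesis by simp
  qed
  also have "nat \<lfloor>y / W\<rfloor> \<le> counting ?B y"
    using counting_fact_multiples_ge[of y m] by (simp add: W_def)
  also have "1 \<le> counting ?B y"
  proof -
    \<comment> \<open>As \<open>ln 1 = 0\<close>, the modulus at 1 is \<open>fact 0 = 1\<close>.
      Membership of 1 lets the count at \<open>y\<close> absorb the extra 1.\<close>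
    have "1 \<in> {n \<in> ?B. 1 \<le> n \<and> real n \<le> y}"
      using y by (auto simp: fact_multiples_def root_log_def)
    then show ?thesis
      unfolding counting_def by (metis One_nat_def Suc_leI card_gt_0_iff empty_iff finite_counting)
  qed
  finally show ?thesis by simp
qed

lemma c_condition_fact_multiples: "c_condition (fact_multiples m)"
  unfolding c_condition_def
proof (intro exI conjI)
  show "\<forall>\<^sub>F x in at_top. real (counting (fact_multiples m) (1 / 2 * x))
      \<ge> 1 / 3 * real (counting (fact_multiples m) x)"
    using eventually_ge_at_top[of 2]
  proof eventually_elim
    case (elim x)
    then show ?case
      using counting_fact_multiples_double[of "x / 2" m] by simp
  qed
qed auto

text \<open>With \<open>t = ln x powr (1 / real m)\<close>, the factorial is at most
  \<open>t powr t\<close>, and \<open>ln t = ln (ln x) / m\<close>.\<close>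

lemma fact_root_log_le:
  assumes "1 \<le> ln x"
  shows "fact (root_log m x) \<le> exp (1 / real m * (ln x powr (1 / real m)) * ln (ln x))"
proof -
  define t where "t = ln x powr (1 / real m)"
  define M where "M = root_log m x"
  have t: "1 \<le> t"
    using assms by (simp add: t_def ge_one_powr_ge_zero)
  then have M: "real M \<le> t"
    by (simp add: M_def root_log_def t_def)
  have "fact M \<le> real M ^ M"
    by (metis fact_le_power le_refl of_nat_fact of_nat_mono of_nat_power)
  also have "\<dots> \<le> t ^ M"
    using M by (intro power_mono) auto
  also have "\<dots> = t powr real M"
    using t by (simp add: powr_realpow)
  also have "\<dots> \<le> t powr t"
    using M t by (intro powr_mono) auto
  also have "\<dots> = exp (1 / real m * t * ln (ln x))"
    using t assms by (simp add: powr_def t_def)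
  finally show ?thesis
    by (simp add: M_def t_def)
qed

text \<open>For \<open>m \<ge> 2\<close> the exponent just found is at most
  \<open>1/2 * sqrt (ln x) * 2 * sqrt (ln x) = ln x\<close>. Hence at least one positive multiple of
  the modulus lies below \<open>x\<close>, and rounding errors can be absorbed.\<close>

lemma fact_root_log_le_self:
  assumes "1 \<le> ln x" "0 < x" "m \<ge> 2"
  shows "fact (root_log m x) \<le> x"
proof -
  have "1 / real m * (ln x powr (1 / real m)) * ln (ln x)
      \<le> 1 / 2 * (ln x powr (1 / 2)) * (2 * sqrt (ln x))"
  proof (intro mult_mono powr_mono)
    show "ln (ln x) \<le> 2 * sqrt (ln x)"
      using assms by (intro ln_le_two_sqrt) linarith
  next
    show "0 \<le> ln (ln x)"
      using assms by (intro ln_ge_zero)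
  qed (use assms in \<open>auto simp: field_simps\<close>)
  also have "\<dots> = ln x"
  proof -
    have "0 \<le> ln x"
      using assms by linarith
    then show ?thesis
      using powr_half_sqrt[of "ln x"] real_sqrt_mult_self[of "ln x"] by simp
  qed
  finally show ?thesis
    using fact_root_log_le[OF assms(1), of m] assms(2)
    by (metis exp_le_cancel_iff exp_ln order_trans)
qed

lemma counting_fact_multiples_bigomega:
  assumes m: "m \<ge> 2"
  shows "(\<lambda>x. real (counting (fact_multiples m) x)) \<in>
    \<Omega>[at_top](\<lambda>x. x * exp (- (2 / real m) * (ln x powr (1 / real m)) * ln (ln x)))"
proof (rule landau_omega.bigI[of "1 / 2"])
  show "\<forall>\<^sub>F x in at_top. norm (real (counting (fact_multiples m) x)) \<ge>
     1 / 2 * norm (x * exp (- (2 / real m) * (ln x powr (1 / real m)) * ln (ln x)))"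
    using eventually_ge_at_top[of "exp 1"]
  proof eventually_elim
    case (elim x)
    then have x: "0 < x" "1 \<le> ln x"
      by (smt (verit) exp_gt_zero, metis exp_gt_zero exp_le_cancel_iff exp_ln less_le_trans)
    define E where "E = 1 / real m * (ln x powr (1 / real m)) * ln (ln x)"
    define q where "q = x / fact (root_log m x)"
    have "E \<ge> 0"
      using x by (simp add: E_def)
    have "1 \<le> q"
      unfolding q_def using fact_root_log_le_self[OF x(2,1) m] by simp
    \<comment> \<open>The construction achieves the exponent \<open>E\<close>; the claimed
      \<open>2 * E\<close> is weaker.\<close>
    have "x * exp (- (2 * E)) \<le> x * exp (- E)"
      using x \<open>E \<ge> 0\<close> by simp
    also have "\<dots> = x / exp E"
      by (simp add: exp_minus divide_inverse)
    also have "\<dots> \<le> q"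
      unfolding q_def E_def using x by (intro divide_left_mono fact_root_log_le) auto
    \<comment> \<open>Since \<open>q \<ge> 1\<close>, taking the floor loses at most a factor 2,
      whence the constant 1/2.\<close>
    also have "q \<le> 2 * real (nat \<lfloor>q\<rfloor>)"
    proof -
      have "1 \<le> real_of_int \<lfloor>q\<rfloor>" "q \<le> real_of_int \<lfloor>q\<rfloor> + 1"
        using \<open>1 \<le> q\<close> by (simp, linarith)
      then show ?thesis by linarith
    qed
    also have "\<dots> \<le> 2 * real (counting (fact_multiples m) x)"
      using counting_fact_multiples_ge[of x m] by (simp add: q_def)
    finally show ?case
      using x by (simp add: E_def mult_ac)
  qed
qed simp


section \<open>Sums of a prime and an element of the set\<close>

text \<open>The sums fall into three classes: \<open>b \<le> z\<close>; \<open>b > z\<close> with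
  \<open>p \<le> M\<close>; and \<open>b > z\<close> with \<open>p > M\<close>. The last two
  contribute \<open>2 * (x / harm M)\<close> each. The cutoff \<open>z\<close> stays free here, and
  \<open>harm M\<close> stands in for the logarithm of \<open>M\<close>.\<close>

lemma counting_primes_plus_le:
  assumes z: "1 \<le> z" and M: "M = root_log m z" "2 \<le> M" and x: "0 < x" "fact M \<le> x"
  shows "real (counting (primes_plus (fact_multiples m)) x) \<le>
    real (card {p::nat. prime p \<and> real p \<le> x}) * z + 4 * (x / harm M)"
proof -
  define W :: nat where "W = fact M"
  define P where "P = {p::nat. prime p \<and> real p \<le> x}"
  define Q where "Q = {n. 1 \<le> n \<and> real n \<le> x \<and> W dvd n}"
  define R where "R = {n. n \<le> nat \<lfloor>x\<rfloor> \<and> coprime n W}"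
  let ?add = "\<lambda>(p, b). p + b :: nat"
  have W: "W \<ge> 2" "real W \<le> x"
    using M x fact_ge_self[of M] by (auto simp: W_def intro: order_trans)
  have harm: "harm M > (0::real)" "harm M \<le> real M"
  proof -
    show "harm M > (0::real)" using M by simp
    have "harm M \<le> (\<Sum>k\<in>{1..M}. 1::real)"
      unfolding harm_def by (intro sum_mono) (auto simp: inverse_le_1_iff)
    then show "harm M \<le> real M" by simp
  qed
  have fin: "finite P" "finite Q" "finite R"
    using finite_subset[OF _ finite_nat_le_real[of "\<lambda>n. 1 \<le> n" x], of Q]
    by (auto simp: P_def R_def Q_def)
  have "{n \<in> primes_plus (fact_multiples m). 1 \<le> n \<and> real n \<le> x} \<subseteq>
      ?add ` (P \<times> {1..nat \<lfloor>z\<rfloor>}) \<union> ?add ` ({1..M} \<times> Q) \<union> R"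
  proof
    fix n assume "n \<in> {n \<in> primes_plus (fact_multiples m). 1 \<le> n \<and> real n \<le> x}"
    then obtain p b where n: "n = p + b" "real n \<le> x" and p: "prime p" and b: "b \<in> fact_multiples m"
      by (auto simp: primes_plus_def)
    have b1: "1 \<le> b"
      using b by (simp add: fact_multiples_def)
    consider "real b \<le> z" | "real b > z" "p \<le> M" | "real b > z" "p > M"
      by linarith
    then show "n \<in> ?add ` (P \<times> {1..nat \<lfloor>z\<rfloor>}) \<union> ?add ` ({1..M} \<times> Q) \<union> R"
    proof cases
      case 1
      then have "(p, b) \<in> P \<times> {1..nat \<lfloor>z\<rfloor>}"
        using n p b1 by (auto simp: P_def le_nat_floor)
      then show ?thesis
        using n by force
    next
      case 2
      then have "W dvd b"
        using fact_multiples_dvd[OF b z] M by (simp add: W_def)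
      then have "(p, b) \<in> {1..M} \<times> Q"
        using 2 n p b1 by (auto simp: Q_def dest: prime_gt_0_nat)
      then show ?thesis
        using n by force
    next
      case 3
      then have "W dvd b"
        using fact_multiples_dvd[OF b z] M by (simp add: W_def)
      \<comment> \<open>Adding a multiple of \<open>W\<close> does not change the gcd with
        \<open>W\<close>, and a prime above \<open>M\<close> does not divide
        \<open>fact M\<close>.\<close>
      then have "gcd (p + b) W = gcd p W"
        by (metis add.commute dvdE gcd.commute gcd_add_mult mult.commute)
      moreover have "coprime p W"
        using 3 p by (intro prime_imp_coprime) (auto simp: W_def prime_dvd_fact_iff)
      ultimately have "coprime (p + b) W"
        by (simp add: coprime_iff_gcd_eq_1)
      then have "n \<in> R"
        using n by (auto simp: R_def le_nat_floor)
      then show ?thesis by simp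
    qed
  qed
  then have "counting (primes_plus (fact_multiples m)) x \<le>
      card (?add ` (P \<times> {1..nat \<lfloor>z\<rfloor>}) \<union> ?add ` ({1..M} \<times> Q) \<union> R)"
    unfolding counting_def using fin by (intro card_mono) auto
  also have "\<dots> \<le> card (?add ` (P \<times> {1..nat \<lfloor>z\<rfloor>})) + card (?add ` ({1..M} \<times> Q)) + card R"
    by (intro order_trans[OF card_Un_le] add_mono card_Un_le order_refl)
  also have "\<dots> \<le> card P * nat \<lfloor>z\<rfloor> + M * card Q + card R"
    using fin card_image_le[of "P \<times> {1..nat \<lfloor>z\<rfloor>}" ?add] card_image_le[of "{1..M} \<times> Q" ?add]
    by (simp add: card_cartesian_product)
  finally have "real (counting (primes_plus (fact_multiples m)) x) \<le>
      real (card P * nat \<lfloor>z\<rfloor> + M * card Q + card R)"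
    by (rule of_nat_mono)
  also have "\<dots> = real (card P) * real (nat \<lfloor>z\<rfloor>) + real M * real (card Q) + real (card R)"
    by simp
  also have "\<dots> \<le> real (card P) * z + 2 * (x / harm M) + 2 * (x / harm M)"
  proof (intro add_mono mult_left_mono)
    show "real (nat \<lfloor>z\<rfloor>) \<le> z"
      using z by simp
    \<comment> \<open>Together with \<open>harm M \<le> M\<close> this gives
      \<open>M / W \<le> 2 / harm M\<close>, so even the crude count of \<open>M * card Q\<close>
      pairs is small enough.\<close>
    have "M * M \<le> 2 * W"
    proof -
      obtain k where k: "M = Suc (Suc k)"
        using M by (metis Suc_le_D numeral_2_eq_2 Suc_le_mono)
      have "Suc k \<le> fact (Suc k)"
        by (rule fact_ge_self)
      then have "Suc (Suc k) * Suc (Suc k) \<le> Suc (Suc k) * (2 * fact (Suc k))"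
        by (intro mult_left_mono) auto
      then show ?thesis
        by (simp add: W_def k algebra_simps)
    qed
    then have "real M * real M \<le> 2 * real W"
      by (metis of_nat_mono of_nat_mult of_nat_numeral)
    moreover have "real M * harm M \<le> real M * real M"
      using harm by (intro mult_left_mono) auto
    ultimately have MW: "real M * harm M \<le> 2 * real W"
      by linarith
    have "real (card Q) \<le> x / W"
      unfolding Q_def using W x by (subst card_multiples) auto
    then have "real M * real (card Q) \<le> real M * (x / W)"
      by (intro mult_left_mono) auto
    also have "\<dots> \<le> 2 * (x / harm M)"
      using mult_left_mono[OF MW, of x] harm W x by (simp add: field_simps)
    finally show "real M * real (card Q) \<le> 2 * (x / harm M)" .
    have "card R \<le> (nat \<lfloor>x\<rfloor> div W + 1) * totient W"
      unfolding R_def using W by (intro card_coprime_le) simp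
    then have "real (card R) \<le> real ((nat \<lfloor>x\<rfloor> div W + 1) * totient W)"
      by (rule of_nat_mono)
    also have "\<dots> = (real (nat \<lfloor>x\<rfloor> div W) + 1) * real (totient W)"
      by (simp add: algebra_simps)
    \<comment> \<open>The second \<open>x / W\<close> bounds the 1 of the incomplete block, by
      \<open>fact M \<le> x\<close>; the last factor is the totient bound.\<close>
    also have "\<dots> \<le> (x / W + x / W) * (real W / harm M)"
    proof (intro mult_mono add_mono)
      have "real (nat \<lfloor>x\<rfloor> div W) \<le> real (nat \<lfloor>x\<rfloor>) / real W"
        by (rule of_nat_div_le_of_nat)
      also have "\<dots> \<le> x / W"
        using x by (intro divide_right_mono) auto
      finally show "real (nat \<lfloor>x\<rfloor> div W) \<le> x / W" .
      show "real (totient W) \<le> real W / harm M"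
        using totient_fact_harm_le[of M] harm by (simp add: W_def field_simps)
    qed (use W x in auto)
    also have "\<dots> = 2 * (x / harm M)"
      using W by (simp add: field_simps)
    finally show "real (card R) \<le> 2 * (x / harm M)" .
  qed auto
  finally show ?thesis
    by (simp add: P_def)
qed

text \<open>The floor in \<open>root_log\<close> costs less than 1, which the \<open>+ 1\<close> in
  \<open>ln (M + 1) \<le> harm M\<close> makes up for.\<close>

lemma harm_root_log_ge:
  assumes "0 < ln z"
  shows "ln (ln z) / real m \<le> harm (root_log m z)"
proof -
  have "ln (ln z) / real m = ln (ln z powr (1 / real m))"
    using assms by (simp add: ln_powr)
  also have "\<dots> \<le> ln (real (root_log m z) + 1)"
  proof (rule ln_mono)
    have "t \<le> real (nat \<lfloor>t\<rfloor>) + 1" for t :: real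
      by linarith
    then show "ln z powr (1 / real m) \<le> real (root_log m z) + 1"
      unfolding root_log_def .
  qed (use assms in auto)
  also have "\<dots> \<le> harm (root_log m z)"
    by (rule ln_le_harm)
  finally show ?thesis .
qed

lemma counting_primes_plus_bigo:
  assumes m: "m \<ge> 2"
  shows "(\<lambda>x. real (counting (primes_plus (fact_multiples m)) x)) \<in> O[at_top](\<lambda>x. x / ln (ln (ln x)))"
\<comment> \<open>The 6 is Chebyshev's constant; \<open>8 * m\<close> is 4 times the factor
  \<open>2 * m\<close> lost in passing from \<open>harm M\<close> to the triple logarithm.\<close>
proof (rule landau_o.bigI[of "6 + 8 * real m"])
  have "filterlim (\<lambda>x. ln (sqrt (ln x)) powr (1 / real m)) at_top at_top"
    using m by real_asymp
  then have "\<forall>\<^sub>F x in at_top. 2 \<le> ln (sqrt (ln x)) powr (1 / real m)"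
    by (auto simp: filterlim_at_top)
  moreover have "\<forall>\<^sub>F x::real in at_top. 1 \<le> x \<and> 1 \<le> sqrt (ln x) \<and> 1 \<le> ln (sqrt (ln x))
      \<and> sqrt (ln x) \<le> x"
    by (intro eventually_conj; real_asymp)
  \<comment> \<open>The square root only subtracts \<open>ln 2\<close> from the triple logarithm, so
    a factor 2 eventually covers the loss.\<close>
  moreover have "\<forall>\<^sub>F x::real in at_top. 0 < ln (ln (ln x)) \<and> ln (ln (ln x)) \<le> sqrt (ln x)
      \<and> ln (ln (ln x)) \<le> 2 * ln (ln (sqrt (ln x)))"
    by (intro eventually_conj; real_asymp)
  ultimately show "\<forall>\<^sub>F x in at_top. norm (real (counting (primes_plus (fact_multiples m)) x)) \<le>
      (6 + 8 * real m) * norm (x / ln (ln (ln x)))"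
  proof eventually_elim
    case (elim x)
    define z where "z = sqrt (ln x)"
    define M where "M = root_log m z"
    define T where "T = ln (ln (ln x))"
    define \<pi> where "\<pi> = real (card {p::nat. prime p \<and> real p \<le> x})"
    have z: "1 \<le> z" "1 \<le> ln z" "z \<le> x" and x: "1 \<le> x"
      and T: "0 < T" "T \<le> z" "T \<le> 2 * ln (ln z)"
      using elim by (auto simp: z_def T_def)
    have zz: "z * z = ln x"
      using x by (simp add: z_def)
    have M2: "2 \<le> M"
      using elim by (auto simp: M_def root_log_def z_def le_nat_iff le_floor_iff)
    have "fact M \<le> x"
      using fact_root_log_le_self[of z m] z m by (simp add: M_def)
    then have "real (counting (primes_plus (fact_multiples m)) x) \<le> \<pi> * z + 4 * (x / harm M)"
      unfolding \<pi>_def using z x M2 by (intro counting_primes_plus_le) (auto simp: M_def)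
    also have "\<pi> * z \<le> 6 * (x / T)"
    proof -
      \<comment> \<open>Because \<open>z * z = ln x\<close>, Chebyshev's bound leaves a spare factor
        \<open>z\<close> after multiplication by \<open>z\<close>, far more than the triple
        logarithm needs.\<close>
      have "\<pi> * (z * z) \<le> 6 * x"
        unfolding \<pi>_def zz by (rule prime_counting_le[OF x])
      then have "\<pi> * z \<le> 6 * (x / z)"
        using z by (simp add: field_simps)
      also have "x / z \<le> x / T"
        using T x z by (intro divide_left_mono) auto
      finally show ?thesis by simp
    qed
    also have "x / harm M \<le> 2 * real m * (x / T)"
    proof -
      have "T / (2 * real m) \<le> ln (ln z) / real m"
        using T m by (simp add: field_simps)
      also have "\<dots> \<le> harm M"
        unfolding M_def using z by (intro harm_root_log_ge) linarith
      finally have "x / harm M \<le> x / (T / (2 * real m))"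
        using T x m M2 by (intro divide_left_mono) auto
      then show ?thesis
        by (simp add: mult_ac)
    qed
    finally show ?case
      using T x by (simp add: T_def algebra_simps)
  qed
qed (use m in auto)

theorem theorem2:
  fixes m :: nat
  assumes "m \<ge> 2"
  shows "\<exists>B :: nat set. B \<subseteq> {1..} \<and> c_condition B \<and>
    (\<lambda>x::real. real (counting B x)) \<in>
      \<Omega>[at_top](\<lambda>x. x * exp (- (2 / real m) * (ln x powr (1 / real m)) * ln (ln x))) \<and>
    (\<lambda>x::real. real (counting (primes_plus B) x)) \<in>
      O[at_top](\<lambda>x. x / ln (ln (ln x)))"
proof (intro exI conjI)
  show "fact_multiples m \<subseteq> {1..}"
    by (auto simp: fact_multiples_def)
qed (intro c_condition_fact_multiples counting_fact_multiples_bigomega[OF assms]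
    counting_primes_plus_bigo[OF assms])+

end
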